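(* Let $A\in\mathbb{R}^{m\times n}$, $b\in\mathbb{R}^m$, $L\in\mathbb{R}^{p\times n}$, and let $k$ be an integer with $2\le k\le n-2$ such that the Golub--Kahan bidiagonalization of $A$ with starting vector $b$ produces $Q_k\in\mathbb{R}^{n\times k}$ and $Q_{k+1}\in\mathbb{R}^{n\times(k+1)}$ without breakdown (all of $\alpha_1,\dots,\alpha_{k+1},\beta_1,\dots,\beta_{k+1}$ are positive). For $j\in\{k,k+1\}$ let $Q_j^{\perp}\in\mathbb{R}^{n\times(n-j)}$ be such that $(Q_j\ \ Q_j^{\perp})$ is an $n\times n$ orthogonal matrix. If $p\ge n-k$, then $$\kappa(LQ_k^{\perp})\ \ge\ \kappa(LQ_{k+1}^{\perp}),$$ that is, $$\kappa\big(L(I_n-Q_kQ_k^T)\big)\ \ge\ \kappa\big(L(I_n-Q_{k+1}Q_{k+1}^T)\big).$$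
   Context: $I_n$ is the $n\times n$ identity matrix. Golub--Kahan (lower) bidiagonalization: set $\beta_1=\|b\|$, $p_1=b/\beta_1$, $\alpha_1q_1=A^Tp_1$, and for $i=1,2,\dots$ $$\beta_{i+1}p_{i+1}=Aq_i-\alpha_ip_i,\qquad \alpha_{i+1}q_{i+1}=A^Tp_{i+1}-\beta_{i+1}q_i,$$ where the normalization constants $\alpha_i,\beta_i\ge 0$ are chosen so that $\|q_i\|=\|p_i\|=1$ (Euclidean norm). Put $Q_j=(q_1,\dots,q_j)\in\mathbb{R}^{n\times j}$; its columns are orthonormal. Condition numbers: for $j\in\{k,k+1\}$, $\kappa(LQ_j^{\perp})=\sigma_{\max}(LQ_j^{\perp})/\sigma_{\min}(LQ_j^{\perp})$, where $\sigma_{\max}$ and $\sigma_{\min}$ are the largest and the smallest (i.e. $(n-j)$-th largest) singular values of the $p\times(n-j)$ matrix $LQ_j^{\perp}$, with the convention $\kappa=+\infty$ if $\sigma_{\min}=0$. Since $L(I_n-Q_jQ_j^T)=LQ_j^{\perp}(Q_j^{\perp})^T$ has the same nonzero singular values as $LQ_j^{\perp}$, the quantity $\kappa(L(I_n-Q_jQ_j^T))$ is understood as the ratio of the largest to the $(n-j)$-th largest singular value of $L(I_n-Q_jQ_j^T)$ (the $j$ trivially zero singular values being discarded), with the same convention $+\infty$ if the latter is zero; when $LQ_j^{\perp}$ has full column rank this is the ratio of the largest to the smallest nonzero singular value. *)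

theory Defs
  imports
    "Jordan_Normal_Form.Char_Poly"
    "HOL-Library.Extended_Real"
begin

definition eucl_norm :: "real vec \<Rightarrow> real" where
  "eucl_norm v = sqrt (v \<bullet> v)"

text \<open>
  The predicate says that the first \<open>N\<close> steps of the (lower) bidiagonalization of \<open>A\<close> with starting
  vector \<open>b\<close> yield the coefficients \<open>\<alpha>\<close>, \<open>\<beta>\<close> and the vectors \<open>u\<close> (left, written $p_i$ in the
  literature) and \<open>q\<close> (right).  Indices run from 1 to \<open>N\<close>; the values of the four sequences at other
  indices are irrelevant.
\<close>

definition golub_kahan ::
  "real mat \<Rightarrow> real vec \<Rightarrow> nat \<Rightarrow> (nat \<Rightarrow> real) \<Rightarrow> (nat \<Rightarrow> real)
    \<Rightarrow> (nat \<Rightarrow> real vec) \<Rightarrow> (nat \<Rightarrow> real vec) \<Rightarrow> bool" where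
  "golub_kahan A b N \<alpha> \<beta> u q \<longleftrightarrow>
     (\<forall>i\<in>{1..N}. u i \<in> carrier_vec (dim_row A) \<and> q i \<in> carrier_vec (dim_col A) \<and>
        \<alpha> i \<ge> 0 \<and> \<beta> i \<ge> 0 \<and> eucl_norm (u i) = 1 \<and> eucl_norm (q i) = 1) \<and>
     \<beta> 1 = eucl_norm b \<and>
     u 1 = (1 / \<beta> 1) \<cdot>\<^sub>v b \<and>
     \<alpha> 1 \<cdot>\<^sub>v q 1 = A\<^sup>T *\<^sub>v u 1 \<and>
     (\<forall>i\<in>{1..<N}.
        \<beta> (i + 1) \<cdot>\<^sub>v u (i + 1) = A *\<^sub>v q i - \<alpha> i \<cdot>\<^sub>v u i \<and>
        \<alpha> (i + 1) \<cdot>\<^sub>v q (i + 1) = A\<^sup>T *\<^sub>v u (i + 1) - \<beta> (i + 1) \<cdot>\<^sub>v q i)"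

definition first_cols :: "nat \<Rightarrow> (nat \<Rightarrow> real vec) \<Rightarrow> nat \<Rightarrow> real mat" where
  "first_cols n q j = mat_of_cols n (map q [1..<j + 1])"

definition hcat :: "real mat \<Rightarrow> real mat \<Rightarrow> real mat" where
  "hcat A B = mat_of_cols (dim_row A) (cols A @ cols B)"

text \<open>
  The constant \<^const>\<open>orthogonal_mat\<close> only demands pairwise orthogonal nonzero columns, not
  orthonormal ones, so the usual notion is introduced here.
\<close>

definition real_orthogonal :: "nat \<Rightarrow> real mat \<Rightarrow> bool" where
  "real_orthogonal n U \<longleftrightarrow>
     U \<in> carrier_mat n n \<and> U\<^sup>T * U = 1\<^sub>m n \<and> U * U\<^sup>T = 1\<^sub>m n"

text \<open>
  The \<open>min (dim_row M) (dim_col M)\<close> singular values of \<open>M\<close> in decreasing order: the square roots of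
  the largest eigenvalues of \<open>M\<^sup>T M\<close>, counted with multiplicity.
\<close>

definition singular_values :: "real mat \<Rightarrow> real list" where
  "singular_values M = take (min (dim_row M) (dim_col M))
     (rev (sorted_list_of_multiset (image_mset sqrt (proots (char_poly (M\<^sup>T * M))))))"

text \<open>List indices start at 0, so the \<open>r\<close>-th largest singular value sits at position \<open>r - 1\<close>.\<close>

definition sigma :: "real mat \<Rightarrow> nat \<Rightarrow> real" where
  "sigma M r = singular_values M ! (r - 1)"

text \<open>
  Largest over \<open>r\<close>-th largest singular value.  Besides defining the condition number, this is the
  meaning of $\kappa$ for a matrix \<open>L * (1\<^sub>m n - Q * Q\<^sup>T)\<close>, where \<open>Q\<close> has \<open>j\<close> orthonormal columns: with
  \<open>r = n - j\<close> it discards the \<open>j\<close> trivially zero singular values.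
\<close>

definition cond_upto :: "nat \<Rightarrow> real mat \<Rightarrow> ereal" where
  "cond_upto r M = (if sigma M r = 0 then \<infinity> else ereal (sigma M 1 / sigma M r))"

definition cond :: "real mat \<Rightarrow> ereal" where
  "cond M = cond_upto (min (dim_row M) (dim_col M)) M"

end

theory Submission
  imports Defs "Jordan_Normal_Form.Schur_Decomposition"
begin

text \<open>
  The columns of \<open>Qk1_perp\<close> lie in the range of \<open>Qk_perp\<close>, so \<open>Qk1_perp = Qk_perp * Z\<close> for a
  matrix \<open>Z\<close> with orthonormal columns. By the variational characterization of the extreme singular
  values, passing from \<open>M\<close> to \<open>M * Z\<close> can only lower the largest and raise the smallest one.
  For the projections, put \<open>M = L * (1 - Q * Q\<^sup>T)\<close> and \<open>N = L * P\<close>, where \<open>(Q P)\<close> is orthogonal.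
  Conjugating \<open>M\<^sup>T * M\<close> by \<open>(Q P)\<close> gives the block diagonal matrix with blocks \<open>0\<close> and
  \<open>N\<^sup>T * N\<close>, so \<open>M\<close> has the singular values of \<open>N\<close> and additional zeros. That the characteristic
  polynomial of a real symmetric matrix splits and that its roots bound the Rayleigh quotient
  follows by deflation with Householder reflections.
\<close>

section \<open>Real inner products and adjoints\<close>

lemma scalar_prod_eq_0_iff_real:
  fixes v :: "real vec"
  assumes "v \<in> carrier_vec n"
  shows "v \<bullet> v = 0 \<longleftrightarrow> v = 0\<^sub>v n"
  using conjugate_square_eq_0_vec[OF assms] by simp

lemma scalar_prod_ge_0_real: "(v :: real vec) \<bullet> v \<ge> 0"
  by (simp add: scalar_prod_def sum_nonneg)

lemma scalar_prod_pos_real: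
  fixes v :: "real vec"
  assumes "v \<in> carrier_vec n" "v \<noteq> 0\<^sub>v n"
  shows "v \<bullet> v > 0"
  using scalar_prod_eq_0_iff_real[OF assms(1)] assms(2) scalar_prod_ge_0_real[of v] by linarith

lemma scalar_prod_mult_mat_vec_transpose:
  fixes A :: "real mat"
  assumes "A \<in> carrier_mat m n" "x \<in> carrier_vec n" "y \<in> carrier_vec m"
  shows "y \<bullet> (A *\<^sub>v x) = (A\<^sup>T *\<^sub>v y) \<bullet> x"
  using assoc_scalar_prod[OF assms(3,1,2)]
    transpose_vec_mult_scalar[OF assms]
  by (smt (verit) assms comm_scalar_prod mult_mat_vec_carrier transpose_carrier_mat)

section \<open>Unit eigenvectors of real symmetric matrices\<close>

text \<open>Over the complex numbers the characteristic polynomial splits, which yields an eigenpair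
  \<open>a\<close>, \<open>z\<close>. Symmetry forces \<open>a\<close> to be real, and then the real
  and imaginary parts of \<open>z\<close> both satisfy the eigenvalue equation; one of them is
  nonzero and can be normalized.\<close>

lemma symmetric_real_eigenvector:
  fixes B :: "real mat"
  assumes B: "B \<in> carrier_mat n n" and sym: "B\<^sup>T = B" and n: "n > 0"
  obtains v l where "v \<in> carrier_vec n" "v \<bullet> v = 1" "B *\<^sub>v v = l \<cdot>\<^sub>v v"
proof -
  let ?C = "map_mat complex_of_real B"
  have C: "?C \<in> carrier_mat n n" using B by simp
  obtain as where as: "char_poly ?C = (\<Prod>a\<leftarrow>as. [:- a, 1:])" "length as = n"
    using char_poly_factorized[OF C] by blast
  then obtain a where "a \<in> set as" using n by (cases as) auto
  then have "poly (char_poly ?C) a = 0"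
    unfolding as(1) by (auto simp: poly_prod_list prod_list_zero_iff image_iff)
  then obtain z where z: "z \<in> carrier_vec n" "z \<noteq> 0\<^sub>v n" "?C *\<^sub>v z = a \<cdot>\<^sub>v z"
    using eigenvalue_root_char_poly[OF C] C unfolding eigenvalue_def eigenvector_def by auto
  define x where "x = map_vec Re z"
  define y where "y = map_vec Im z"
  have x: "x \<in> carrier_vec n" and y: "y \<in> carrier_vec n" using z by (auto simp: x_def y_def)
  have comp: "(\<Sum>j<n. of_real (B $$ (i,j)) * z $ j) = a * z $ i" if "i < n" for i
    using arg_cong[OF z(3), of "\<lambda>v. v $ i"] that B z(1)
    by (simp add: scalar_prod_def lessThan_atLeast0)
  \<comment> \<open>As \<open>B\<close> is real, the real and imaginary parts of the equation for
    \<open>z\<close> separate into a coupled pair for \<open>x\<close> and \<open>y\<close>.\<close>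
  have Bx: "B *\<^sub>v x = Re a \<cdot>\<^sub>v x - Im a \<cdot>\<^sub>v y"
  proof (rule eq_vecI)
    fix i assume "i < dim_vec (Re a \<cdot>\<^sub>v x - Im a \<cdot>\<^sub>v y)"
    then have i: "i < n" using y by simp
    show "(B *\<^sub>v x) $ i = (Re a \<cdot>\<^sub>v x - Im a \<cdot>\<^sub>v y) $ i"
      using arg_cong[OF comp[OF i], of Re] i B z(1)
      by (simp add: scalar_prod_def lessThan_atLeast0 x_def y_def Re_sum)
  qed (use B x y in auto)
  have By: "B *\<^sub>v y = Re a \<cdot>\<^sub>v y + Im a \<cdot>\<^sub>v x"
  proof (rule eq_vecI)
    fix i assume "i < dim_vec (Re a \<cdot>\<^sub>v y + Im a \<cdot>\<^sub>v x)"
    then have i: "i < n" using x by simp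
    show "(B *\<^sub>v y) $ i = (Re a \<cdot>\<^sub>v y + Im a \<cdot>\<^sub>v x) $ i"
      using arg_cong[OF comp[OF i], of Im] i B z(1)
      by (simp add: scalar_prod_def lessThan_atLeast0 x_def y_def Im_sum)
  qed (use B x y in auto)
  have nz: "x \<noteq> 0\<^sub>v n \<or> y \<noteq> 0\<^sub>v n"
  proof (rule ccontr)
    assume "\<not> ?thesis"
    then have "x $ i = 0" "y $ i = 0" if "i < n" for i using that by auto
    then have "z $ i = 0" if "i < n" for i
      using that z(1) by (auto simp: x_def y_def complex_eq_iff)
    then have "z = 0\<^sub>v n" using z(1) by (intro eq_vecI) auto
    then show False using z(2) by simp
  qed
  \<comment> \<open>Inserting \<open>Bx\<close> and \<open>By\<close> into this symmetry relation,
    the terms with \<open>Re a\<close> cancel and only \<open>Im a\<close> times the squared norm of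
    \<open>z\<close> remains.\<close>
  have "x \<bullet> (B *\<^sub>v y) = (B *\<^sub>v x) \<bullet> y"
    using scalar_prod_mult_mat_vec_transpose[OF B y x] sym by simp
  then have "Im a * (x \<bullet> x + y \<bullet> y) = 0"
    using x y unfolding Bx By
    by (simp add: scalar_prod_add_distrib[of _ n] minus_scalar_prod_distrib[of _ n] algebra_simps)
  moreover have "x \<bullet> x + y \<bullet> y > 0"
    using nz scalar_prod_pos_real[OF x] scalar_prod_pos_real[OF y]
      scalar_prod_ge_0_real[of x] scalar_prod_ge_0_real[of y] by (smt (verit))
  ultimately have "Im a = 0" by simp
  then have "B *\<^sub>v x = Re a \<cdot>\<^sub>v x" "B *\<^sub>v y = Re a \<cdot>\<^sub>v y"
    unfolding Bx By using x y by auto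
  then obtain w where w: "w \<in> carrier_vec n" "w \<noteq> 0\<^sub>v n" "B *\<^sub>v w = Re a \<cdot>\<^sub>v w"
    using nz x y by blast
  define c where "c = 1 / sqrt (w \<bullet> w)"
  have "c * c * (w \<bullet> w) = 1"
    using scalar_prod_pos_real[OF w(1,2)] unfolding c_def by simp
  then have "(c \<cdot>\<^sub>v w) \<bullet> (c \<cdot>\<^sub>v w) = 1" using w(1) by (simp add: mult.assoc)
  moreover have "B *\<^sub>v (c \<cdot>\<^sub>v w) = Re a \<cdot>\<^sub>v (c \<cdot>\<^sub>v w)"
    using w B by (simp add: mult_mat_vec[OF B w(1)] smult_smult_assoc mult.commute)
  ultimately show ?thesis using that[of "c \<cdot>\<^sub>v w" "Re a"] w(1) by simp
qed

section \<open>Householder reflections\<close>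

lemma eq_one_mat_on_vecI:
  fixes H :: "real mat"
  assumes H: "H \<in> carrier_mat n n" and id: "\<And>x. x \<in> carrier_vec n \<Longrightarrow> H *\<^sub>v x = x"
  shows "H = 1\<^sub>m n"
proof (rule eq_matI)
  fix i j assume ij: "i < dim_row (1\<^sub>m n)" "j < dim_col (1\<^sub>m n)"
  have "H $$ (i,j) = (H *\<^sub>v unit_vec n j) $ i" using H ij by simp
  then show "H $$ (i,j) = 1\<^sub>m n $$ (i,j)" using id[of "unit_vec n j"] ij by simp
qed (use H in auto)

text \<open>The Householder reflection in the hyperplane orthogonal to \<open>v - unit_vec n 0\<close>.\<close>

lemma reflection_to_unit_vector:
  fixes v :: "real vec"
  assumes v: "v \<in> carrier_vec n" and v1: "v \<bullet> v = 1" and n: "n > 0"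
  obtains H where "H \<in> carrier_mat n n" "H\<^sup>T = H" "H * H = 1\<^sub>m n" "H *\<^sub>v unit_vec n 0 = v"
proof (cases "v = unit_vec n 0")
  case True
  then show ?thesis using that[of "1\<^sub>m n"] by simp
next
  case False
  define w where "w = v - unit_vec n 0"
  define d where "d = w \<bullet> w"
  define H where "H = mat n n (\<lambda>(i,j). (if i = j then 1 else 0) - 2 / d * w $ i * w $ j)"
  have w: "w \<in> carrier_vec n" using v by (simp add: w_def)
  have vw: "v = unit_vec n 0 + w" using v unfolding w_def by (intro eq_vecI) auto
  have "w \<noteq> 0\<^sub>v n" using False v unfolding vw by auto
  then have d: "d > 0" unfolding d_def by (rule scalar_prod_pos_real[OF w])
  have Hc: "H \<in> carrier_mat n n" by (simp add: H_def)
  have Ht: "H\<^sup>T = H" unfolding H_def by (intro eq_matI) auto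
  \<comment> \<open>The rank-one form of the reflection; all later facts about \<open>H\<close>
    acting on vectors come from it.\<close>
  have Hx: "H *\<^sub>v x = x - (2 / d * (w \<bullet> x)) \<cdot>\<^sub>v w" if x: "x \<in> carrier_vec n" for x
  proof (rule eq_vecI)
    fix i assume "i < dim_vec (x - (2 / d * (w \<bullet> x)) \<cdot>\<^sub>v w)"
    then have i: "i < n" using w by simp
    have "(H *\<^sub>v x) $ i = (\<Sum>j<n. ((if i = j then 1 else 0) - 2 / d * w $ i * w $ j) * x $ j)"
      using i x by (simp add: H_def scalar_prod_def lessThan_atLeast0)
    also have "\<dots> = (\<Sum>j<n. (if i = j then x $ j else 0) - (2 / d * w $ i) * (w $ j * x $ j))"
      by (intro sum.cong) (auto simp: algebra_simps)
    also have "\<dots> = x $ i - (2 / d * w $ i) * (w \<bullet> x)"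
      using i x by (simp only: sum_subtractf sum_distrib_left[symmetric] scalar_prod_def
          lessThan_atLeast0) simp
    finally show "(H *\<^sub>v x) $ i = (x - (2 / d * (w \<bullet> x)) \<cdot>\<^sub>v w) $ i" using i w x by simp
  qed (use w x in \<open>auto simp: H_def\<close>)
  have "H * H = 1\<^sub>m n"
  proof (rule eq_one_mat_on_vecI)
    fix x :: "real vec" assume x: "x \<in> carrier_vec n"
    let ?y = "x - (2 / d * (w \<bullet> x)) \<cdot>\<^sub>v w"
    \<comment> \<open>The reflection flips the component along \<open>w\<close>, so a second
      application restores what the first one removed.\<close>
    have "w \<bullet> ?y = - (w \<bullet> x)"
      using w x d by (simp add: scalar_prod_minus_distrib[of _ n] d_def[symmetric])
    then have "H *\<^sub>v ?y = ?y + (2 / d * (w \<bullet> x)) \<cdot>\<^sub>v w"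
      using Hx[of ?y] w x by (intro eq_vecI) auto
    also have "\<dots> = x" using w x by (intro eq_vecI) auto
    finally show "H * H *\<^sub>v x = x"
      using assoc_mult_mat_vec[OF Hc Hc x] Hx[OF x] by simp
  qed (use Hc in auto)
  moreover have "H *\<^sub>v unit_vec n 0 = v"
  proof -
    let ?e = "unit_vec n 0 :: real vec"
    have e: "?e \<bullet> ?e = 1" using n by simp
    \<comment> \<open>Since \<open>v\<close> and \<open>?e\<close> are both unit vectors and
      \<open>v = ?e + w\<close>, expanding the square determines the inner product of
      \<open>w\<close> and \<open>?e\<close>. The coefficient in \<open>Hx\<close> becomes -1, so
      \<open>H\<close> sends \<open>?e\<close> to \<open>?e + w\<close>.\<close>
    have "v \<bullet> v = ?e \<bullet> ?e + 2 * (w \<bullet> ?e) + d"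
      using w comm_scalar_prod[OF w unit_vec_carrier[of n 0]] unfolding vw d_def
      by (simp add: add_scalar_prod_distrib[of _ n] scalar_prod_add_distrib[of _ n])
    then have "2 * (w \<bullet> ?e) = - d" using v1 e by simp
    then have "2 / d * (w \<bullet> ?e) = -1" using d by (simp add: field_simps)
    then have "H *\<^sub>v ?e = ?e - (-1) \<cdot>\<^sub>v w" using Hx[of ?e] by simp
    also have "\<dots> = v" unfolding vw using w by (intro eq_vecI) auto
    finally show ?thesis .
  qed
  ultimately show ?thesis using that Hc Ht by blast
qed

section \<open>Splitting of the characteristic polynomial and Rayleigh bounds\<close>

text \<open>Deflation by induction on \<open>n\<close>: a reflection carries a unit eigenvector to
  the first unit vector, which makes \<open>B\<close> similar to a block diagonal matrix with blocks
  \<mu> and a smaller symmetric \<open>D\<close>. Both the characteristic polynomial and the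
  quadratic form split accordingly. Stating the bounds for an arbitrary bound \<open>l\<close> on
  the roots lets them pass to the tail of the list and covers the empty list.\<close>

lemma symmetric_spectral_bounds:
  fixes B :: "real mat"
  assumes "B \<in> carrier_mat n n" and "B\<^sup>T = B"
  shows "\<exists>es. length es = n \<and> char_poly B = (\<Prod>e\<leftarrow>es. [:- e, 1:]) \<and>
    (\<forall>l x. x \<in> carrier_vec n \<longrightarrow> (\<forall>e\<in>set es. l \<le> e) \<longrightarrow> l * (x \<bullet> x) \<le> x \<bullet> (B *\<^sub>v x)) \<and>
    (\<forall>l x. x \<in> carrier_vec n \<longrightarrow> (\<forall>e\<in>set es. e \<le> l) \<longrightarrow> x \<bullet> (B *\<^sub>v x) \<le> l * (x \<bullet> x))"
  using assms
proof (induction n arbitrary: B)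
  case 0
  then have "char_poly B = 1" using degree_monic_char_poly[OF 0(1)]
    by (metis degree_0_id one_pCons)
  then show ?case using 0 by (intro exI[of _ "[]"]) (auto simp: scalar_prod_def)
next
  case (Suc n)
  note B = Suc.prems(1) and sym = Suc.prems(2)
  let ?N = "Suc n"
  obtain v \<mu> where v: "v \<in> carrier_vec ?N" "v \<bullet> v = 1" "B *\<^sub>v v = \<mu> \<cdot>\<^sub>v v"
    using symmetric_real_eigenvector[OF B sym] by blast
  obtain H where H: "H \<in> carrier_mat ?N ?N" "H\<^sup>T = H" "H * H = 1\<^sub>m ?N" "H *\<^sub>v unit_vec ?N 0 = v"
    using reflection_to_unit_vector[OF v(1,2)] by blast
  \<comment> \<open>As \<open>H\<close> is its own inverse, this is a similarity; as
    \<open>H\<close> is also symmetric, \<open>C\<close> stays symmetric.\<close>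
  define C where "C = H * B * H"
  have C: "C \<in> carrier_mat ?N ?N" using H B by (simp add: C_def)
  have Csym: "C\<^sup>T = C"
  proof -
    have "C\<^sup>T = H * (B * H)"
      using H B sym transpose_mult[of "H * B" ?N ?N H ?N] transpose_mult[of H ?N ?N B ?N]
      unfolding C_def by simp
    then show ?thesis using H B by (simp add: C_def assoc_mult_mat[of H ?N ?N B ?N H ?N])
  qed
  have HH: "H *\<^sub>v (H *\<^sub>v x) = x" if "x \<in> carrier_vec ?N" for x
    using assoc_mult_mat_vec[OF H(1) H(1) that] H(3) that by simp
  have "C *\<^sub>v unit_vec ?N 0 = H *\<^sub>v (B *\<^sub>v v)"
    using H B by (simp add: C_def assoc_mult_mat_vec[of _ ?N ?N _ ?N])
  also have "\<dots> = \<mu> \<cdot>\<^sub>v unit_vec ?N 0"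
    using HH[of "unit_vec ?N 0"] H v by (simp add: mult_mat_vec[OF H(1) v(1)])
  finally have "(C *\<^sub>v unit_vec ?N 0) $ i = (\<mu> \<cdot>\<^sub>v unit_vec ?N 0) $ i" for i by simp
  \<comment> \<open>The first column is a multiple of the first unit vector; symmetry carries this
    over to the first row, which gives the block form.\<close>
  then have Ci0: "C $$ (i,0) = (if i = 0 then \<mu> else 0)" if "i < ?N" for i
  proof -
    have "C $$ (i,0) = (C *\<^sub>v unit_vec ?N 0) $ i" using that C by simp
    also have "\<dots> = (\<mu> \<cdot>\<^sub>v unit_vec ?N 0) $ i" by fact
    also have "\<dots> = (if i = 0 then \<mu> else 0)" using that by simp
    finally show ?thesis .
  qed
  have C0i: "C $$ (0,i) = (if i = 0 then \<mu> else 0)" if "i < ?N" for i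
    using Ci0[OF that] Csym that C by (metis carrier_matD index_transpose_mat(1) zero_less_Suc)
  define D where "D = mat n n (\<lambda>(i,j). C $$ (Suc i, Suc j))"
  define M where "M = mat 1 1 (\<lambda>_. \<mu>)"
  have D: "D \<in> carrier_mat n n" and M: "M \<in> carrier_mat 1 1" by (auto simp: D_def M_def)
  have Cblock: "C = four_block_mat M (0\<^sub>m 1 n) (0\<^sub>m n 1) D"
    using C Ci0 C0i by (intro eq_matI) (auto simp: D_def M_def)
  have "D\<^sup>T = D"
  proof (rule eq_matI)
    fix i j assume ij: "i < dim_row D" "j < dim_col D"
    then have "C\<^sup>T $$ (Suc i, Suc j) = C $$ (Suc j, Suc i)" using C by (simp add: D_def)
    then show "D\<^sup>T $$ (i,j) = D $$ (i,j)" using ij Csym by (simp add: D_def)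
  qed (auto simp: D_def)
  from Suc.IH[OF D this] obtain es where es: "length es = n" "char_poly D = (\<Prod>e\<leftarrow>es. [:- e, 1:])"
    "\<And>l x. x \<in> carrier_vec n \<Longrightarrow> (\<forall>e\<in>set es. l \<le> e) \<Longrightarrow> l * (x \<bullet> x) \<le> x \<bullet> (D *\<^sub>v x)"
    "\<And>l x. x \<in> carrier_vec n \<Longrightarrow> (\<forall>e\<in>set es. e \<le> l) \<Longrightarrow> x \<bullet> (D *\<^sub>v x) \<le> l * (x \<bullet> x)"
    by blast
  have "similar_mat_wit C B H H"
    by (rule similar_mat_witI[of _ _ ?N]) (use H B C in \<open>auto simp: C_def\<close>)
  then have "char_poly B = char_poly C"
    using char_poly_similar similar_mat_def by metis
  also have "\<dots> = char_poly M * char_poly D"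
    unfolding Cblock by (rule char_poly_four_block_zeros_col[OF M _ D]) simp
  also have "char_poly M = [:- \<mu>, 1:]"
    by (subst char_poly_upper_triangular[OF M]) (auto simp: M_def diag_mat_def)
  finally have cp: "char_poly B = (\<Prod>e\<leftarrow>\<mu> # es. [:- e, 1:])" using es(2) by simp
  \<comment> \<open>In the coordinates \<open>y = H *\<^sub>v x\<close> the first entry
    \<open>a\<close> and the remaining part \<open>z\<close> decouple, while \<open>H\<close>
    preserves the norm.\<close>
  have split: "\<exists>a z. z \<in> carrier_vec n \<and> x \<bullet> x = a * a + z \<bullet> z \<and>
      x \<bullet> (B *\<^sub>v x) = \<mu> * (a * a) + z \<bullet> (D *\<^sub>v z)" if x: "x \<in> carrier_vec ?N" for x
  proof -
    define y where "y = H *\<^sub>v x"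
    have y: "y \<in> carrier_vec ?N" using H x by (simp add: y_def)
    have xy: "x = H *\<^sub>v y" using HH[OF x] by (simp add: y_def)
    define f where "f = vec_first y 1"
    define z where "z = vec_last y n"
    have f: "f \<in> carrier_vec 1" and z: "z \<in> carrier_vec n" by (auto simp: f_def z_def)
    have yfz: "y = f @\<^sub>v z" using y by (simp add: f_def z_def vec_first_last_append[of _ 1 n])
    have "B *\<^sub>v x = H *\<^sub>v (C *\<^sub>v y)"
    proof -
      have "C *\<^sub>v y = H *\<^sub>v (B *\<^sub>v x)"
        using H B y xy by (simp add: C_def assoc_mult_mat_vec[of _ ?N ?N _ ?N])
      then show ?thesis using HH[of "B *\<^sub>v x"] B x by simp
    qed
    then have "x \<bullet> (B *\<^sub>v x) = y \<bullet> (C *\<^sub>v y)"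
      using scalar_prod_mult_mat_vec_transpose[OF H(1) _ x, of "C *\<^sub>v y"] C y H(2)
      by (simp add: y_def)
    moreover have "C *\<^sub>v y = (M *\<^sub>v f) @\<^sub>v (D *\<^sub>v z)"
      unfolding Cblock yfz
      by (subst four_block_mat_mult_vec[OF M _ _ D f z]) (use f z M D in auto)
    then have "y \<bullet> (C *\<^sub>v y) = f \<bullet> (M *\<^sub>v f) + z \<bullet> (D *\<^sub>v z)"
      unfolding yfz using f z M D
      by (simp add: scalar_prod_append[of _ 1 _ n])
    moreover have "f \<bullet> (M *\<^sub>v f) = \<mu> * (f $ 0 * f $ 0)" "f \<bullet> f = f $ 0 * f $ 0"
      using f by (auto simp: M_def scalar_prod_def)
    moreover have "x \<bullet> x = y \<bullet> y"
      using scalar_prod_mult_mat_vec_transpose[OF H(1) y x]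
      unfolding H(2) xy[symmetric] y_def[symmetric] .
    moreover have "y \<bullet> y = f \<bullet> f + z \<bullet> z"
      unfolding yfz using f z by (simp add: scalar_prod_append[of _ 1 _ n])
    ultimately show ?thesis using z by (intro exI[of _ "f $ 0"] exI[of _ z]) simp
  qed
  show ?case
  proof (intro exI[of _ "\<mu> # es"] conjI allI impI)
    fix l and x :: "real vec" assume x: "x \<in> carrier_vec ?N" and l: "\<forall>e\<in>set (\<mu> # es). l \<le> e"
    from split[OF x] obtain a z where az: "z \<in> carrier_vec n" "x \<bullet> x = a * a + z \<bullet> z"
      "x \<bullet> (B *\<^sub>v x) = \<mu> * (a * a) + z \<bullet> (D *\<^sub>v z)" by blast
    \<comment> \<open>The first coordinate is controlled by comparing \<open>l\<close> with \<mu>,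
      the rest by the induction hypothesis for \<open>D\<close>.\<close>
    have "l * (a * a) \<le> \<mu> * (a * a)" using l by (intro mult_right_mono) auto
    then show "l * (x \<bullet> x) \<le> x \<bullet> (B *\<^sub>v x)"
      using es(3)[OF az(1), of l] l az by (simp add: distrib_left)
  next
    fix l and x :: "real vec" assume x: "x \<in> carrier_vec ?N" and l: "\<forall>e\<in>set (\<mu> # es). e \<le> l"
    from split[OF x] obtain a z where az: "z \<in> carrier_vec n" "x \<bullet> x = a * a + z \<bullet> z"
      "x \<bullet> (B *\<^sub>v x) = \<mu> * (a * a) + z \<bullet> (D *\<^sub>v z)" by blast
    have "\<mu> * (a * a) \<le> l * (a * a)" using l by (intro mult_right_mono) auto
    then show "x \<bullet> (B *\<^sub>v x) \<le> l * (x \<bullet> x)"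
      using es(4)[OF az(1), of l] l az by (simp add: distrib_left)
  qed (use es cp in auto)
qed

section \<open>Singular values through the spectrum of the Gram matrix\<close>

lemma proots_linear_factors:
  fixes es :: "'a :: idom list"
  shows "proots (\<Prod>e\<leftarrow>es. [:- e, 1:]) = mset es"
proof (induction es)
  case (Cons e es)
  have "(\<Prod>e\<leftarrow>es. [:- e, 1:]) \<noteq> (0 :: 'a poly)"
    by (auto simp: prod_list_zero_iff)
  then have "proots ([:- e, 1:] * (\<Prod>e\<leftarrow>es. [:- e, 1:])) = proots [:- e, 1:] + mset es"
    using Cons.IH by (subst proots_mult) auto
  then show ?case by (simp only: list.map prod_list.Cons proots_linear_factor) simp
qed simp

lemma singular_values_conv_eigenvalues:
  assumes "char_poly (M\<^sup>T * M) = (\<Prod>e\<leftarrow>es. [:- e, 1:])"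
  shows "singular_values M = take (min (dim_row M) (dim_col M)) (rev (sort (map sqrt es)))"
  unfolding singular_values_def assms proots_linear_factors
  by (simp add: mset_map[symmetric] sorted_list_of_multiset_mset del: mset_map)

lemma gram_scalar_prod:
  fixes M :: "real mat"
  assumes "M \<in> carrier_mat p d" "x \<in> carrier_vec d"
  shows "x \<bullet> ((M\<^sup>T * M) *\<^sub>v x) = (M *\<^sub>v x) \<bullet> (M *\<^sub>v x)"
proof -
  have "(M\<^sup>T * M) *\<^sub>v x = M\<^sup>T *\<^sub>v (M *\<^sub>v x)" by (rule assoc_mult_mat_vec) (use assms in auto)
  then show ?thesis
    using scalar_prod_mult_mat_vec_transpose[of "M\<^sup>T" d p "M *\<^sub>v x" x] assms by simp
qed

text \<open>The Gram matrix is symmetric and its quadratic form at \<open>x\<close> is the squared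
  norm of \<open>M *\<^sub>v x\<close>. The spectral bounds therefore become bounds on this norm,
  and an eigenvector for \<open>e\<close> realizes the ratio \<open>e\<close>, which is hence
  nonnegative.\<close>

lemma gram_spectrum:
  fixes M :: "real mat"
  assumes M: "M \<in> carrier_mat p d"
  obtains es where "length es = d" "char_poly (M\<^sup>T * M) = (\<Prod>e\<leftarrow>es. [:- e, 1:])"
    "\<And>e. e \<in> set es \<Longrightarrow> e \<ge> 0"
    "\<And>e. e \<in> set es \<Longrightarrow>
      \<exists>x\<in>carrier_vec d. x \<noteq> 0\<^sub>v d \<and> (M *\<^sub>v x) \<bullet> (M *\<^sub>v x) = e * (x \<bullet> x)"
    "\<And>l x. x \<in> carrier_vec d \<Longrightarrow> (\<And>e. e \<in> set es \<Longrightarrow> l \<le> e) \<Longrightarrow> l * (x \<bullet> x) \<le> (M *\<^sub>v x) \<bullet> (M *\<^sub>v x)"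
    "\<And>l x. x \<in> carrier_vec d \<Longrightarrow> (\<And>e. e \<in> set es \<Longrightarrow> e \<le> l) \<Longrightarrow> (M *\<^sub>v x) \<bullet> (M *\<^sub>v x) \<le> l * (x \<bullet> x)"
proof -
  let ?G = "M\<^sup>T * M"
  have G: "?G \<in> carrier_mat d d" "?G\<^sup>T = ?G"
    using M transpose_mult[of "M\<^sup>T" d p M d] by auto
  obtain es where es: "length es = d" "char_poly ?G = (\<Prod>e\<leftarrow>es. [:- e, 1:])"
    "\<And>l x. x \<in> carrier_vec d \<Longrightarrow> (\<forall>e\<in>set es. l \<le> e) \<Longrightarrow> l * (x \<bullet> x) \<le> x \<bullet> (?G *\<^sub>v x)"
    "\<And>l x. x \<in> carrier_vec d \<Longrightarrow> (\<forall>e\<in>set es. e \<le> l) \<Longrightarrow> x \<bullet> (?G *\<^sub>v x) \<le> l * (x \<bullet> x)"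
    using symmetric_spectral_bounds[OF G] by blast
  have ev: "\<exists>x\<in>carrier_vec d. x \<noteq> 0\<^sub>v d \<and> (M *\<^sub>v x) \<bullet> (M *\<^sub>v x) = e * (x \<bullet> x)" if e: "e \<in> set es" for e
  proof -
    have "poly (char_poly ?G) e = 0"
      unfolding es(2) using e by (auto simp: poly_prod_list prod_list_zero_iff image_iff)
    then have "eigenvalue ?G e" using eigenvalue_root_char_poly[OF G(1)] by blast
    then obtain x where x: "x \<in> carrier_vec d" "x \<noteq> 0\<^sub>v d" "?G *\<^sub>v x = e \<cdot>\<^sub>v x"
      using G(1) unfolding eigenvalue_def eigenvector_def by (metis carrier_matD(1))
    then have "(M *\<^sub>v x) \<bullet> (M *\<^sub>v x) = e * (x \<bullet> x)"
      using gram_scalar_prod[OF M x(1)] by simp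
    then show ?thesis using x by blast
  qed
  moreover have "e \<ge> 0" if e: "e \<in> set es" for e
  proof -
    obtain x where x: "x \<in> carrier_vec d" "x \<noteq> 0\<^sub>v d" "(M *\<^sub>v x) \<bullet> (M *\<^sub>v x) = e * (x \<bullet> x)"
      using ev[OF e] by blast
    have "e * (x \<bullet> x) \<ge> 0" using scalar_prod_ge_0_real[of "M *\<^sub>v x"] x(3) by simp
    then show ?thesis using scalar_prod_pos_real[OF x(1,2)] by (simp add: zero_le_mult_iff)
  qed
  ultimately show ?thesis
    using that[of es] es gram_scalar_prod[OF M] by metis
qed

section \<open>Extreme singular values and compression by an isometry\<close>

text \<open>With \<open>d \<le> p\<close> no root of the Gram polynomial is cut off, so
  \<open>sigma M 1\<close> and \<open>sigma M d\<close> are the square roots of its largest and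
  smallest eigenvalue. The Rayleigh bounds and their eigenvectors then give the variational
  description.\<close>

lemma sigma_extremal:
  assumes M: "M \<in> carrier_mat p d" and d: "0 < d" "d \<le> p"
  shows sigma_nonneg: "sigma M 1 \<ge> 0" "sigma M d \<ge> 0"
    and sigma_bounds: "x \<in> carrier_vec d \<Longrightarrow> (sigma M d)\<^sup>2 * (x \<bullet> x) \<le> (M *\<^sub>v x) \<bullet> (M *\<^sub>v x)"
      "x \<in> carrier_vec d \<Longrightarrow> (M *\<^sub>v x) \<bullet> (M *\<^sub>v x) \<le> (sigma M 1)\<^sup>2 * (x \<bullet> x)"
    and sigma_attained:
      "\<exists>x\<in>carrier_vec d. x \<noteq> 0\<^sub>v d \<and> (M *\<^sub>v x) \<bullet> (M *\<^sub>v x) = (sigma M 1)\<^sup>2 * (x \<bullet> x)"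
      "\<exists>x\<in>carrier_vec d. x \<noteq> 0\<^sub>v d \<and> (M *\<^sub>v x) \<bullet> (M *\<^sub>v x) = (sigma M d)\<^sup>2 * (x \<bullet> x)"
proof -
  obtain es where es: "length es = d" "char_poly (M\<^sup>T * M) = (\<Prod>e\<leftarrow>es. [:- e, 1:])"
    "\<And>e. e \<in> set es \<Longrightarrow> e \<ge> 0"
    "\<And>e. e \<in> set es \<Longrightarrow>
      \<exists>x\<in>carrier_vec d. x \<noteq> 0\<^sub>v d \<and> (M *\<^sub>v x) \<bullet> (M *\<^sub>v x) = e * (x \<bullet> x)"
    "\<And>l x. x \<in> carrier_vec d \<Longrightarrow> (\<And>e. e \<in> set es \<Longrightarrow> l \<le> e) \<Longrightarrow> l * (x \<bullet> x) \<le> (M *\<^sub>v x) \<bullet> (M *\<^sub>v x)"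
    "\<And>l x. x \<in> carrier_vec d \<Longrightarrow> (\<And>e. e \<in> set es \<Longrightarrow> e \<le> l) \<Longrightarrow> (M *\<^sub>v x) \<bullet> (M *\<^sub>v x) \<le> l * (x \<bullet> x)"
    using gram_spectrum[OF M] by blast
  define S where "S = sort (map sqrt es)"
  have S: "length S = d" "sorted S" "set S = sqrt ` set es" using es(1) by (auto simp: S_def)
  have sv: "singular_values M = rev S"
    using singular_values_conv_eigenvalues[OF es(2)] M d S(1) by (simp add: S_def)
  \<comment> \<open>\<open>S\<close> is ascending while singular values are listed in descending
    order, so the two ends are exchanged.\<close>
  have s1: "sigma M 1 = S ! (d - 1)" and sd: "sigma M d = S ! 0"
    using S(1) d by (simp_all add: sigma_def sv rev_nth)
  have mem: "S ! (d - 1) \<in> sqrt ` set es" "S ! 0 \<in> sqrt ` set es"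
    using S d nth_mem[of _ S] by auto
  obtain e1 where e1: "e1 \<in> set es" "sigma M 1 = sqrt e1" using mem s1 by auto
  obtain ed where ed: "ed \<in> set es" "sigma M d = sqrt ed" using mem sd by auto
  have le: "ed \<le> e" "e \<le> e1" if "e \<in> set es" for e
  proof -
    have "sqrt e \<in> set S" using that S(3) by blast
    then obtain i where i: "i < d" "S ! i = sqrt e" using S(1) by (auto simp: in_set_conv_nth)
    have "S ! 0 \<le> S ! i" "S ! i \<le> S ! (d - 1)"
      using i(1) S d by (intro sorted_nth_mono; simp)+
    then show "ed \<le> e" "e \<le> e1" using i(2) e1(2) ed(2) s1 sd by (metis real_sqrt_le_iff)+
  qed
  have sq: "(sigma M 1)\<^sup>2 = e1" "(sigma M d)\<^sup>2 = ed" using e1 ed es(3) by auto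
  show "sigma M 1 \<ge> 0" "sigma M d \<ge> 0" using e1 ed es(3) by auto
  show "x \<in> carrier_vec d \<Longrightarrow> (sigma M d)\<^sup>2 * (x \<bullet> x) \<le> (M *\<^sub>v x) \<bullet> (M *\<^sub>v x)"
    "x \<in> carrier_vec d \<Longrightarrow> (M *\<^sub>v x) \<bullet> (M *\<^sub>v x) \<le> (sigma M 1)\<^sup>2 * (x \<bullet> x)"
    unfolding sq using es(5,6) le by blast+
  show "\<exists>x\<in>carrier_vec d. x \<noteq> 0\<^sub>v d \<and> (M *\<^sub>v x) \<bullet> (M *\<^sub>v x) = (sigma M 1)\<^sup>2 * (x \<bullet> x)"
    "\<exists>x\<in>carrier_vec d. x \<noteq> 0\<^sub>v d \<and> (M *\<^sub>v x) \<bullet> (M *\<^sub>v x) = (sigma M d)\<^sup>2 * (x \<bullet> x)"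
    unfolding sq using es(4) e1(1) ed(1) by blast+
qed

text \<open>An isometry \<open>Z\<close> makes every ratio of norms attained by \<open>M * Z\<close>
  also a ratio attained by \<open>M\<close>, so the range of these ratios can only shrink.\<close>

lemma cond_mult_isometry_le:
  assumes M: "M \<in> carrier_mat p d" and Z: "Z \<in> carrier_mat d c" and iso: "Z\<^sup>T * Z = 1\<^sub>m c"
    and c: "0 < c" "c \<le> d" and d: "d \<le> p"
  shows "cond (M * Z) \<le> cond M"
proof -
  have MZ: "M * Z \<in> carrier_mat p c" using M Z by simp
  have d0: "0 < d" and cp: "c \<le> p" using c d by auto
  have Zx: "(Z *\<^sub>v x) \<bullet> (Z *\<^sub>v x) = x \<bullet> x" if "x \<in> carrier_vec c" for x
    using gram_scalar_prod[OF Z that] iso that by simp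
  have MZx: "(M * Z) *\<^sub>v x = M *\<^sub>v (Z *\<^sub>v x)" if "x \<in> carrier_vec c" for x
    using assoc_mult_mat_vec[OF M Z that] .
  \<comment> \<open>A maximizer for \<open>M * Z\<close>; its image under \<open>Z\<close> has the
    same norm and competes in the maximum for \<open>M\<close>. The minimizer \<open>y\<close> below
    is used in the same way.\<close>
  obtain x where x: "x \<in> carrier_vec c" "x \<noteq> 0\<^sub>v c"
    "((M * Z) *\<^sub>v x) \<bullet> ((M * Z) *\<^sub>v x) = (sigma (M * Z) 1)\<^sup>2 * (x \<bullet> x)"
    using sigma_attained(1)[OF MZ c(1) cp] by blast
  have "(sigma (M * Z) 1)\<^sup>2 * (x \<bullet> x) \<le> (sigma M 1)\<^sup>2 * (x \<bullet> x)"
    using sigma_bounds(2)[OF M d0 d, of "Z *\<^sub>v x"] x Z Zx MZx by simp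
  then have max_le: "sigma (M * Z) 1 \<le> sigma M 1"
    using scalar_prod_pos_real[OF x(1,2)]
    by (intro power2_le_imp_le[OF _ sigma_nonneg(1)[OF M d0 d]]) simp
  obtain y where y: "y \<in> carrier_vec c" "y \<noteq> 0\<^sub>v c"
    "((M * Z) *\<^sub>v y) \<bullet> ((M * Z) *\<^sub>v y) = (sigma (M * Z) c)\<^sup>2 * (y \<bullet> y)"
    using sigma_attained(2)[OF MZ c(1) cp] by blast
  have "(sigma M d)\<^sup>2 * (y \<bullet> y) \<le> (sigma (M * Z) c)\<^sup>2 * (y \<bullet> y)"
    using sigma_bounds(1)[OF M d0 d, of "Z *\<^sub>v y"] y Z Zx MZx by simp
  then have min_le: "sigma M d \<le> sigma (M * Z) c"
    using scalar_prod_pos_real[OF y(1,2)]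
    by (intro power2_le_imp_le[OF _ sigma_nonneg(2)[OF MZ c(1) cp]]) simp
  have mins: "min (dim_row M) (dim_col M) = d" "min (dim_row (M * Z)) (dim_col (M * Z)) = c"
    using M Z d cp by auto
  show ?thesis
  \<comment> \<open>If the smallest singular value of \<open>M\<close> vanishes,
    \<open>cond M\<close> is infinite. Otherwise \<open>min_le\<close> makes the one of
    \<open>M * Z\<close> positive as well, and both condition numbers are genuine quotients.\<close>
  proof (cases "sigma M d = 0")
    case True
    then show ?thesis unfolding cond_def mins by (simp add: cond_upto_def)
  next
    case False
    then have "sigma M d > 0" using sigma_nonneg(2)[OF M d0 d] by simp
    then have "sigma (M * Z) 1 / sigma (M * Z) c \<le> sigma M 1 / sigma M d"
      using max_le min_le sigma_nonneg(1)[OF MZ c(1) cp] by (intro frac_le) auto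
    then show ?thesis
      using False \<open>sigma M d > 0\<close> min_le unfolding cond_def mins by (simp add: cond_upto_def)
  qed
qed

section \<open>Concatenated columns and orthogonal matrices\<close>

lemma hcat_carrier:
  assumes "X \<in> carrier_mat n a" "Y \<in> carrier_mat n c"
  shows "hcat X Y \<in> carrier_mat n (a + c)"
  using assms unfolding hcat_def by (simp add: mat_of_cols_def)

lemma hcat_index:
  assumes "X \<in> carrier_mat n a" "Y \<in> carrier_mat n c" "i < n" "j < a + c"
  shows "hcat X Y $$ (i,j) = (if j < a then X $$ (i,j) else Y $$ (i, j - a))"
  using assms unfolding hcat_def by (auto simp: mat_of_cols_index nth_append)

lemma col_hcat:
  assumes "X \<in> carrier_mat n a" "Y \<in> carrier_mat n c" "j < a + c"
  shows "col (hcat X Y) j = (if j < a then col X j else col Y (j - a))"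
  using assms hcat_carrier[OF assms(1,2)] hcat_index[OF assms(1,2)] by (intro eq_vecI) auto

lemma mult_hcat:
  assumes "W \<in> carrier_mat p n" "X \<in> carrier_mat n a" "Y \<in> carrier_mat n c"
  shows "W * hcat X Y = hcat (W * X) (W * Y)"
proof (rule eq_matI)
  have c: "hcat X Y \<in> carrier_mat n (a + c)" "hcat (W * X) (W * Y) \<in> carrier_mat p (a + c)"
    using hcat_carrier[OF assms(2,3)]
      hcat_carrier[OF mult_carrier_mat[OF assms(1,2)] mult_carrier_mat[OF assms(1,3)]] by simp_all
  then show "dim_row (W * hcat X Y) = dim_row (hcat (W * X) (W * Y))"
    "dim_col (W * hcat X Y) = dim_col (hcat (W * X) (W * Y))" using assms by auto
  fix i j assume "i < dim_row (hcat (W * X) (W * Y))" "j < dim_col (hcat (W * X) (W * Y))"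
  then have ij: "i < p" "j < a + c" using c by auto
  then show "(W * hcat X Y) $$ (i,j) = hcat (W * X) (W * Y) $$ (i,j)"
    using assms c by (simp add: hcat_index[of "W * X" p a "W * Y" c] col_hcat[OF assms(2,3)])
qed

lemma gram_hcat:
  assumes X: "X \<in> carrier_mat n a" and Y: "Y \<in> carrier_mat n c"
  shows "(hcat X Y)\<^sup>T * hcat X Y = four_block_mat (X\<^sup>T * X) (X\<^sup>T * Y) (Y\<^sup>T * X) (Y\<^sup>T * Y)"
  using X Y hcat_carrier[OF X Y]
  by (intro eq_matI) (auto simp: col_hcat[OF X Y])

text \<open>The product of the transpose with the matrix, read block by block, gives the
  orthonormality relations. The product in the other order gives the last claim: the projections
  onto the two column spaces add up to the identity.\<close>

lemma real_orthogonal_hcatD: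
  assumes X: "X \<in> carrier_mat n a" and Y: "Y \<in> carrier_mat n c" and orth: "real_orthogonal n (hcat X Y)"
  shows "n = a + c" "X\<^sup>T * X = 1\<^sub>m a" "X\<^sup>T * Y = 0\<^sub>m a c" "Y\<^sup>T * X = 0\<^sub>m c a" "Y\<^sup>T * Y = 1\<^sub>m c"
    "Y * Y\<^sup>T = 1\<^sub>m n - X * X\<^sup>T"
proof -
  have hc: "hcat X Y \<in> carrier_mat n (a + c)" using hcat_carrier[OF X Y] .
  show n: "n = a + c" using hc orth unfolding real_orthogonal_def by auto
  have "four_block_mat (X\<^sup>T * X) (X\<^sup>T * Y) (Y\<^sup>T * X) (Y\<^sup>T * Y) = 1\<^sub>m n"
    using orth gram_hcat[OF X Y] unfolding real_orthogonal_def by simp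
  then have "four_block_mat (X\<^sup>T * X) (X\<^sup>T * Y) (Y\<^sup>T * X) (Y\<^sup>T * Y) $$ (i,j) = 1\<^sub>m n $$ (i,j)" for i j
    by simp
  note * = this
  have e1: "(X\<^sup>T * X) $$ (i,j) = 1\<^sub>m a $$ (i,j)" if "i < a" "j < a" for i j
    using *[of i j] that X Y n by simp
  have e2: "(X\<^sup>T * Y) $$ (i,j) = 0\<^sub>m a c $$ (i,j)" if "i < a" "j < c" for i j
    using *[of i "j + a"] that X Y n by simp
  have e3: "(Y\<^sup>T * X) $$ (i,j) = 0\<^sub>m c a $$ (i,j)" if "i < c" "j < a" for i j
    using *[of "i + a" j] that X Y n by simp
  have e4: "(Y\<^sup>T * Y) $$ (i,j) = 1\<^sub>m c $$ (i,j)" if "i < c" "j < c" for i j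
    using *[of "i + a" "j + a"] that X Y n by simp
  show "X\<^sup>T * X = 1\<^sub>m a" using X by (intro eq_matI e1) auto
  show "X\<^sup>T * Y = 0\<^sub>m a c" using X Y by (intro eq_matI e2) auto
  show "Y\<^sup>T * X = 0\<^sub>m c a" using X Y by (intro eq_matI e3) auto
  show "Y\<^sup>T * Y = 1\<^sub>m c" using Y by (intro eq_matI e4) auto
  show "Y * Y\<^sup>T = 1\<^sub>m n - X * X\<^sup>T"
  proof (rule eq_matI)
    fix i j assume "i < dim_row (1\<^sub>m n - X * X\<^sup>T)" "j < dim_col (1\<^sub>m n - X * X\<^sup>T)"
    then have ij: "i < n" "j < n" using X by auto
    have "1\<^sub>m n $$ (i,j) = (hcat X Y * (hcat X Y)\<^sup>T) $$ (i,j)"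
      using orth unfolding real_orthogonal_def by simp
    also have "\<dots> = (\<Sum>l<a + c. hcat X Y $$ (i,l) * hcat X Y $$ (j,l))"
      using ij hc by (simp add: scalar_prod_def lessThan_atLeast0)
    also have "\<dots> = (\<Sum>l<a + c. if l < a then X $$ (i,l) * X $$ (j,l) else Y $$ (i,l - a) * Y $$ (j,l - a))"
      using ij by (intro sum.cong) (auto simp: hcat_index[OF X Y])
    also have "\<dots> = (\<Sum>l<a. X $$ (i,l) * X $$ (j,l)) + (\<Sum>l<c. Y $$ (i,l) * Y $$ (j,l))"
      by (induction c) auto
    also have "\<dots> = (X * X\<^sup>T) $$ (i,j) + (Y * Y\<^sup>T) $$ (i,j)"
      using ij X Y by (simp add: scalar_prod_def lessThan_atLeast0)
    finally show "(Y * Y\<^sup>T) $$ (i,j) = (1\<^sub>m n - X * X\<^sup>T) $$ (i,j)" using ij X Y by simp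
  qed (use X Y in auto)
qed

section \<open>Condition numbers of projected matrices\<close>

lemma cond_upto_complementary_projection:
  assumes L: "L \<in> carrier_mat p n" and Q: "Q \<in> carrier_mat n a" and P: "P \<in> carrier_mat n c"
    and orth: "real_orthogonal n (hcat Q P)" and c: "0 < c" "c \<le> p"
  shows "cond_upto c (L * (1\<^sub>m n - Q * Q\<^sup>T)) = cond (L * P)"
proof -
  note o = real_orthogonal_hcatD[OF Q P orth]
  define M where "M = L * (1\<^sub>m n - Q * Q\<^sup>T)"
  define N where "N = L * P"
  define U where "U = hcat Q P"
  have proj: "1\<^sub>m n - Q * Q\<^sup>T \<in> carrier_mat n n" using Q by auto
  have M: "M \<in> carrier_mat p n" and N: "N \<in> carrier_mat p c"
    using L P mult_carrier_mat[OF L proj] by (auto simp: M_def N_def)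
  have U: "U \<in> carrier_mat n n" "U\<^sup>T * U = 1\<^sub>m n" "U * U\<^sup>T = 1\<^sub>m n"
    using orth by (auto simp: real_orthogonal_def U_def)
  have PPt: "P * P\<^sup>T \<in> carrier_mat n n" using P by simp
  \<comment> \<open>The projection is rewritten as \<open>P * P\<^sup>T\<close>, so \<open>M\<close>
    annihilates the columns of \<open>Q\<close> and acts on those of \<open>P\<close> as
    \<open>L\<close> does.\<close>
  have MX: "M * X = L * (P * (P\<^sup>T * X))" if X: "X \<in> carrier_mat n r" for X r
    using assoc_mult_mat[OF L PPt X] assoc_mult_mat[of P n c "P\<^sup>T" n X r] P X
    unfolding M_def o(6)[symmetric] by simp
  have MQ: "M * Q = 0\<^sub>m p a" using MX[OF Q] o(4) P L by simp
  have MP: "M * P = N" using MX[OF P] o(5) P by (simp add: N_def)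
  have MU: "M * U = hcat (0\<^sub>m p a) N" unfolding U_def using mult_hcat[OF M Q P] MQ MP by simp
  have NN: "N\<^sup>T * N \<in> carrier_mat c c" using N by simp
  obtain es where es: "length es = c" "char_poly (N\<^sup>T * N) = (\<Prod>e\<leftarrow>es. [:- e, 1:])"
    "\<And>e. e \<in> set es \<Longrightarrow> e \<ge> 0"
    by (rule gram_spectrum[OF N]) (rule that)
  have zero: "char_poly (0\<^sub>m a a :: real mat) = (\<Prod>e\<leftarrow>replicate a 0. [:- e, 1:])"
  proof -
    have "diag_mat (0\<^sub>m a a :: real mat) = replicate a 0"
      by (intro nth_equalityI) (auto simp: diag_mat_def)
    then show ?thesis using char_poly_upper_triangular[of "0\<^sub>m a a :: real mat" a] by simp
  qed
  have "(M * U)\<^sup>T * (M * U) = four_block_mat (0\<^sub>m a a) (0\<^sub>m a c) (0\<^sub>m c a) (N\<^sup>T * N)"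
    unfolding MU using gram_hcat[of "0\<^sub>m p a" p a N c] N by simp
  moreover have "(M * U)\<^sup>T * (M * U) = U\<^sup>T * (M\<^sup>T * M) * U"
    using M U(1) by (simp add: transpose_mult[OF M U(1)] assoc_mult_mat[of _ n p M n U n]
        assoc_mult_mat[of "U\<^sup>T" n n _ p _ n] assoc_mult_mat[of "U\<^sup>T" n n _ n _ n])
  ultimately have block: "U\<^sup>T * (M\<^sup>T * M) * U = four_block_mat (0\<^sub>m a a) (0\<^sub>m a c) (0\<^sub>m c a) (N\<^sup>T * N)"
    by simp
  \<comment> \<open>Orthogonality of \<open>U\<close> turns the congruence into a similarity, so the
    block form determines the characteristic polynomial.\<close>
  have "similar_mat_wit (U\<^sup>T * (M\<^sup>T * M) * U) (M\<^sup>T * M) (U\<^sup>T) U"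
    by (rule similar_mat_witI[of _ _ n]) (use U M in auto)
  then have "char_poly (M\<^sup>T * M) = char_poly (U\<^sup>T * (M\<^sup>T * M) * U)"
    using char_poly_similar similar_mat_def by metis
  also have "\<dots> = char_poly (0\<^sub>m a a :: real mat) * char_poly (N\<^sup>T * N)"
    unfolding block
    by (rule char_poly_0_block[OF refl exI[of _ "replicate a 0"] exI[of _ es] _ _ NN])
      (simp_all only: zero es(2) zero_carrier_mat)
  also have "\<dots> = (\<Prod>e\<leftarrow>replicate a 0 @ es. [:- e, 1:])" unfolding zero es(2) by simp
  finally have cpM: "char_poly (M\<^sup>T * M) = (\<Prod>e\<leftarrow>replicate a 0 @ es. [:- e, 1:])" .
  define S where "S = sort (map sqrt es)"
  have S: "length S = c" using es(1) by (simp add: S_def)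
  \<comment> \<open>The roots in \<open>es\<close> are nonnegative, so the \<open>a\<close>
    additional zeros may be placed first in ascending order, hence last among the singular
    values.\<close>
  have "sort (map sqrt (replicate a 0 @ es)) = replicate a 0 @ S"
    by (rule properties_for_sort) (use es(3) in \<open>auto simp: S_def sorted_append\<close>)
  then have svM: "singular_values M = take (min p n) (rev S @ replicate a 0)"
    using singular_values_conv_eigenvalues[OF cpM] M by simp
  have svN: "singular_values N = rev S"
    using singular_values_conv_eigenvalues[OF es(2)] N c S by (simp add: S_def)
  \<comment> \<open>The truncation at \<open>min p n\<close> keeps at least the first
    \<open>c\<close> entries, because \<open>c \<le> p\<close> and \<open>n = a + c\<close>; these
    are the entries of \<open>rev S\<close>.\<close>
  have "sigma M r = sigma N r" if "0 < r" "r \<le> c" for r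
  proof -
    have "r - 1 < c" "r - 1 < min p n" using that c o(1) by linarith+
    then show ?thesis using S unfolding sigma_def svM svN by (simp add: nth_append)
  qed
  then have "cond_upto c M = cond_upto c N" using c by (simp add: cond_upto_def)
  then show ?thesis using c N by (simp add: cond_def M_def[symmetric] N_def[symmetric])
qed

section \<open>Monotonicity of the condition numbers\<close>

theorem theorem3p2:
  fixes A L Qk_perp Qk1_perp :: "real mat" and b :: "real vec"
    and m n p k :: nat
    and \<alpha> \<beta> :: "nat \<Rightarrow> real" and u q :: "nat \<Rightarrow> real vec"
  assumes A: "A \<in> carrier_mat m n"
    and b: "b \<in> carrier_vec m"
    and L: "L \<in> carrier_mat p n"
    and k: "2 \<le> k" "k + 2 \<le> n"
    and gk: "golub_kahan A b (k + 1) \<alpha> \<beta> u q"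
    and no_breakdown: "\<forall>i\<in>{1..k + 1}. \<alpha> i > 0 \<and> \<beta> i > 0"
    and perp_k: "Qk_perp \<in> carrier_mat n (n - k)"
      "real_orthogonal n (hcat (first_cols n q k) Qk_perp)"
    and perp_k1: "Qk1_perp \<in> carrier_mat n (n - (k + 1))"
      "real_orthogonal n (hcat (first_cols n q (k + 1)) Qk1_perp)"
    and p: "p \<ge> n - k"
  shows "cond (L * Qk_perp) \<ge> cond (L * Qk1_perp) \<and>
    cond_upto (n - k) (L * (1\<^sub>m n - first_cols n q k * (first_cols n q k)\<^sup>T))
      \<ge> cond_upto (n - (k + 1)) (L * (1\<^sub>m n - first_cols n q (k + 1) * (first_cols n q (k + 1))\<^sup>T))"
proof -
  let ?Q = "first_cols n q k" and ?Q1 = "first_cols n q (k + 1)"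
  let ?d = "n - k" and ?c = "n - (k + 1)"
  have Q: "?Q \<in> carrier_mat n k" and Q1: "?Q1 \<in> carrier_mat n (k + 1)"
    unfolding first_cols_def by (rule carrier_matI; simp)+
  note P = perp_k(1) and P1 = perp_k1(1)
  note o = real_orthogonal_hcatD[OF Q P perp_k(2)] and o1 = real_orthogonal_hcatD[OF Q1 P1 perp_k1(2)]
  have col_eq: "col ?Q i = col ?Q1 i" if "i < k" for i
    using that Q Q1 by (intro eq_vecI) (auto simp: first_cols_def mat_of_cols_index nth_append)
  \<comment> \<open>The columns of \<open>?Q\<close> are the first \<open>k\<close> columns of
    \<open>?Q1\<close>, so they are orthogonal to \<open>Qk1_perp\<close> too.\<close>
  have QP1: "?Q\<^sup>T * Qk1_perp = 0\<^sub>m k ?c"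
  proof (rule eq_matI)
    fix i j assume "i < dim_row (0\<^sub>m k ?c :: real mat)" "j < dim_col (0\<^sub>m k ?c :: real mat)"
    then have ij: "i < k" "j < ?c" by auto
    have "(?Q\<^sup>T * Qk1_perp) $$ (i,j) = (?Q1\<^sup>T * Qk1_perp) $$ (i,j)"
      using ij Q Q1 P1 col_eq by simp
    then show "(?Q\<^sup>T * Qk1_perp) $$ (i,j) = 0\<^sub>m k ?c $$ (i,j)" using o1(3) ij by simp
  qed (use Q P1 in auto)
  \<comment> \<open>The coordinates of the columns of \<open>Qk1_perp\<close> in the orthonormal
    basis formed by the columns of \<open>Qk_perp\<close>.\<close>
  define Z where "Z = Qk_perp\<^sup>T * Qk1_perp"
  have Z: "Z \<in> carrier_mat ?d ?c" using P P1 by (simp add: Z_def)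
  have PZ: "Qk_perp * Z = Qk1_perp"
  proof -
    have QQ: "?Q * ?Q\<^sup>T \<in> carrier_mat n n" using Q by simp
    have "Qk_perp * Z = (1\<^sub>m n - ?Q * ?Q\<^sup>T) * Qk1_perp"
      using assoc_mult_mat[of Qk_perp n ?d "Qk_perp\<^sup>T" n Qk1_perp ?c] P P1 o(6) by (simp add: Z_def)
    also have "\<dots> = Qk1_perp - ?Q * (?Q\<^sup>T * Qk1_perp)"
      using minus_mult_distrib_mat[OF one_carrier_mat QQ P1]
        assoc_mult_mat[of ?Q n k "?Q\<^sup>T" n Qk1_perp ?c] Q P1 by simp
    also have "\<dots> = Qk1_perp" unfolding QP1 using Q P1 by (intro eq_matI) auto
    finally show ?thesis .
  qed
  have "Z\<^sup>T = Qk1_perp\<^sup>T * Qk_perp"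
    using P P1 transpose_mult[of "Qk_perp\<^sup>T" ?d n Qk1_perp ?c] by (simp add: Z_def)
  \<comment> \<open>Regrouping the product as \<open>Qk1_perp\<^sup>T * (Qk_perp * Z)\<close>
    reduces it to the Gram matrix of \<open>Qk1_perp\<close>.\<close>
  then have iso: "Z\<^sup>T * Z = 1\<^sub>m ?c"
    using assoc_mult_mat[of "Qk1_perp\<^sup>T" ?c n Qk_perp ?d Z ?c] P P1 Z PZ o1(5) by simp
  have "L * Qk_perp * Z = L * Qk1_perp" using assoc_mult_mat[OF L P Z] PZ by simp
  \<comment> \<open>Here \<open>k + 2 \<le> n\<close> makes \<open>?c\<close> positive, and
    \<open>p \<ge> n - k\<close> ensures that \<open>L * Qk_perp\<close> has at least as many rows
    as columns.\<close>
  then have main: "cond (L * Qk1_perp) \<le> cond (L * Qk_perp)"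
    using cond_mult_isometry_le[of "L * Qk_perp" p ?d Z ?c] L P Z iso k p by simp
  moreover have "cond_upto ?d (L * (1\<^sub>m n - ?Q * ?Q\<^sup>T)) = cond (L * Qk_perp)"
    using cond_upto_complementary_projection[OF L Q P perp_k(2)] k p by simp
  moreover have "cond_upto ?c (L * (1\<^sub>m n - ?Q1 * ?Q1\<^sup>T)) = cond (L * Qk1_perp)"
    using cond_upto_complementary_projection[OF L Q1 P1 perp_k1(2)] k p by simp
  ultimately show ?thesis by simp
qed

end
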